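(* If $(X,\|\cdot\|)$ is a $2$-uniformly PL-convex complex Banach space, then the norm $\|\cdot\|:X\to\mathbb{R}$ is strictly plurisubharmonic on average continuously.
   Context: A complex Banach space $(X,\|\cdot\|)$ is $2$-uniformly PL-convex if, for $0<q<\infty$, there exists $\lambda>0$ such that $$\Big(\frac1{2\pi}\int_0^{2\pi}\|a+e^{i\theta}b\|^q\,d\theta\Big)^{1/q}\ge(\|a\|^2+\lambda\|b\|^2)^{1/2}\quad\text{for all }a,b\in X;$$ it is known that this property does not depend on the choice of $q\in(0,\infty)$ (the constant $\lambda$ may depend on $q$). For an open $U\subset X$ (here $U=X$), an upper semicontinuous $g:U\to[-\infty,\infty)$ is strictly plurisubharmonic on average continuously if there exist a positive continuous function $\varphi:U\to\mathbb{R}$ and a lower semicontinuous $\delta:U\to(0,\infty)$ such that for all $a\in U$ and all $b\in X$ with $\|b\|<\delta(a)$ (where $\delta(a)$ is small enough that $a+\overline{\mathbb{D}}b\subset U$ for such $b$, $\overline{\mathbb D}$ being the closed unit disk of $\mathbb{C}$), $$\varphi(a)\|b\|^2+g(a)\le\frac1{2\pi}\int_0^{2\pi}g(a+e^{i\theta}b)\,d\theta.$$ *)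

theory Defs
  imports "HOL-Analysis.Analysis"
begin

text \<open>
  The distribution only has real Banach spaces. A complex Banach space is a real one with a
  compatible complex scalar multiplication for which the norm is homogeneous.
\<close>

class complex_banach = banach +
  fixes scaleC :: "complex \<Rightarrow> 'a \<Rightarrow> 'a" (infixr \<open>*\<^sub>C\<close> 75)
  assumes scaleC_add_right: "c *\<^sub>C (x + y) = c *\<^sub>C x + c *\<^sub>C y"
    and scaleC_add_left: "(c + d) *\<^sub>C x = c *\<^sub>C x + d *\<^sub>C x"
    and scaleC_scaleC: "c *\<^sub>C d *\<^sub>C x = (c * d) *\<^sub>C x"
    and scaleC_one: "1 *\<^sub>C x = x"
    and scaleC_of_real: "complex_of_real r *\<^sub>C x = r *\<^sub>R x"
    and norm_scaleC: "norm (c *\<^sub>C x) = cmod c * norm x"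

text \<open>
  The property is independent of the exponent \<open>q\<close>; asking for the inequality
  for some \<open>q\<close> makes it formally weakest. The constant \<open>c\<close> may depend on \<open>q\<close>.
\<close>

definition two_uniformly_PL_convex :: "'a::complex_banach itself \<Rightarrow> bool" where
  "two_uniformly_PL_convex (_ :: 'a itself) \<longleftrightarrow>
     (\<exists>q::real>0. \<exists>c::real>0. \<forall>a b :: 'a.
        (1 / (2 * pi) * integral {0..2 * pi} (\<lambda>\<theta>. norm (a + cis \<theta> *\<^sub>C b) powr q)) powr (1 / q)
          \<ge> sqrt ((norm a)\<^sup>2 + c * (norm b)\<^sup>2))"

definition usc_on :: "'a::topological_space set \<Rightarrow> ('a \<Rightarrow> 'b::linorder) \<Rightarrow> bool" where
  "usc_on U g \<longleftrightarrow> (\<forall>t. openin (top_of_set U) {x \<in> U. g x < t})"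

definition lsc_on :: "'a::topological_space set \<Rightarrow> ('a \<Rightarrow> 'b::linorder) \<Rightarrow> bool" where
  "lsc_on U g \<longleftrightarrow> (\<forall>t. openin (top_of_set U) {x \<in> U. t < g x})"

text \<open>
  Lebesgue integral of an extended-real-valued function, as the integral of its positive part minus
  that of its negative part (\<open>e2ennreal\<close> sends negative values to 0). An upper semicontinuous
  function with values below \<open>\<infinity>\<close> is bounded above on a circle, so for those
  the first term is finite and the value \<open>-\<infinity>\<close> is allowed.
\<close>

definition circle_mean :: "('a::complex_banach \<Rightarrow> ereal) \<Rightarrow> 'a \<Rightarrow> 'a \<Rightarrow> ereal" where
  "circle_mean g a b =
     ereal (1 / (2 * pi)) *
       (enn2ereal (\<integral>\<^sup>+\<theta>\<in>{0..2 * pi}. e2ennreal (g (a + cis \<theta> *\<^sub>C b)) \<partial>lborel)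
        - enn2ereal (\<integral>\<^sup>+\<theta>\<in>{0..2 * pi}. e2ennreal (- g (a + cis \<theta> *\<^sub>C b)) \<partial>lborel))"

definition strictly_psh_on_average_continuously ::
    "'a::complex_banach set \<Rightarrow> ('a \<Rightarrow> ereal) \<Rightarrow> bool" where
  "strictly_psh_on_average_continuously U g \<longleftrightarrow>
     open U \<and> usc_on U g \<and> (\<forall>x\<in>U. g x < \<infinity>) \<and>
     (\<exists>(\<phi> :: 'a \<Rightarrow> real) (\<delta> :: 'a \<Rightarrow> real).
        continuous_on U \<phi> \<and> (\<forall>x\<in>U. \<phi> x > 0) \<and>
        lsc_on U \<delta> \<and> (\<forall>x\<in>U. \<delta> x > 0) \<and>
        (\<forall>a\<in>U. \<forall>b. norm b < \<delta> a \<longrightarrow>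
           (\<forall>\<zeta>\<in>cball 0 1. a + \<zeta> *\<^sub>C b \<in> U) \<and>
           ereal (\<phi> a * (norm b)\<^sup>2) + g a \<le> circle_mean g a b))"

end

theory Submission
  imports Defs
begin

text \<open>
  The definition demands a lower bound for the mean of the norm itself over a circle, whereas
  uniform PL-convexity bounds a mean of its \<open>q\<close>-th power, with \<open>q\<close> possibly large. The whole
  difficulty is to descend from \<open>q\<close> to \<open>1\<close>.

  Normalise to \<open>\<parallel>a\<parallel> = 1\<close>, \<open>\<parallel>b\<parallel> \<le> 1\<close>, and let \<open>u(\<theta>) = \<parallel>a + e\<^sup>i\<^sup>\<theta>b\<parallel> - 1\<close>, so \<open>\<bar>u\<bar> \<le> 1\<close>. By Jensen's
  inequality the exponent may be raised to a natural number \<open>n \<ge> 2\<close>, which gives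
  \<open>mean (1 + u)\<^sup>n \<ge> 1 + c\<parallel>b\<parallel>\<^sup>2\<close>. Since \<open>(1 + u)\<^sup>n \<le> 1 + nu + 3\<^sup>nu\<^sup>2\<close>, this becomes
  \<open>n mean u + 3\<^sup>n mean u\<^sup>2 \<ge> c\<parallel>b\<parallel>\<^sup>2\<close>, and it remains to see that the quadratic term is controlled
  by the linear one. A merely convex function such as \<open>u = Re (e\<^sup>i\<^sup>\<theta>w)\<close> would violate this; what
  excludes it is complex linearity. A complex functional norming \<open>a\<close> provides a \<open>w\<close> with
  \<open>1 + u \<ge> \<bar>1 + e\<^sup>i\<^sup>\<theta>w\<bar>\<close>. The right-hand side exceeds its linearisation \<open>1 + Re (e\<^sup>i\<^sup>\<theta>w)\<close> by a
  multiple of \<open>(Im (e\<^sup>i\<^sup>\<theta>w))\<^sup>2\<close>, so \<open>mean u\<close> dominates \<open>\<bar>w\<bar>\<^sup>2\<close>. The rest \<open>u - Re (e\<^sup>i\<^sup>\<theta>w)\<close> is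
  nonnegative and bounded, so its square is dominated by itself, and its mean is again \<open>mean u\<close>.
  Hence \<open>mean u\<^sup>2 \<le> 36 mean u\<close> (\<open>mean_square_increment_le\<close>), and \<open>mean u \<ge> \<kappa>\<parallel>b\<parallel>\<^sup>2\<close>
  (\<open>mean_norm_ge_unit\<close>).

  Scaling handles \<open>\<parallel>b\<parallel> \<le> \<parallel>a\<parallel>\<close> with the factor \<open>\<kappa>/\<parallel>a\<parallel>\<close>. For larger \<open>b\<close> the mean is a convex
  function of the radius, so its excess over \<open>\<parallel>a\<parallel>\<close> grows at least linearly beyond radius
  \<open>\<parallel>a\<parallel>\<close>. Both cases are covered by \<open>\<phi>(a) = \<kappa>/(1 + \<parallel>a\<parallel>)\<close> and the constant radius
  \<open>\<delta> = 1\<close> (\<open>mean_norm_ge\<close>).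
\<close>

section \<open>Complex multiplication and norming functionals\<close>

lemma norm_cis_scaleC [simp]: "norm (cis \<theta> *\<^sub>C (b :: 'a::complex_banach)) = norm b"
  by (simp add: norm_scaleC)

lemma scaleC_zero_left [simp]: "0 *\<^sub>C (x :: 'a::complex_banach) = 0"
  using norm_scaleC[of 0 x] by simp

lemma scaleC_scaleR: "c *\<^sub>C (r *\<^sub>R (x :: 'a::complex_banach)) = r *\<^sub>R (c *\<^sub>C x)"
  by (simp add: scaleC_of_real [symmetric] scaleC_scaleC mult.commute)

lemma bounded_linear_scaleC_left: "bounded_linear (\<lambda>c. c *\<^sub>C (x :: 'a::complex_banach))"
proof (rule bounded_linear_intro)
  show "(c + d) *\<^sub>C x = c *\<^sub>C x + d *\<^sub>C x" for c d
    by (rule scaleC_add_left)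
  show "(r *\<^sub>R c) *\<^sub>C x = r *\<^sub>R (c *\<^sub>C x)" for r c
    by (simp add: scaleC_of_real [symmetric] scaleC_scaleC scaleR_conv_of_real)
  show "norm (c *\<^sub>C x) \<le> norm c * norm x" for c
    by (simp add: norm_scaleC)
qed

lemma continuous_on_circle_norm:
  "continuous_on S (\<lambda>\<theta>. norm (a + cis \<theta> *\<^sub>C (b :: 'a::complex_banach)))"
proof -
  have "continuous_on S (\<lambda>\<theta>. cis \<theta> *\<^sub>C b)"
    by (intro bounded_linear.continuous_on[OF bounded_linear_scaleC_left] continuous_intros)
  then show ?thesis
    by (intro continuous_intros)
qed

text \<open>
  This is the complex Hahn-Banach theorem for the span of \<open>a\<close> and \<open>b\<close>: if \<open>\<ell>\<close> is a functional of
  norm one with \<open>\<ell> a = 1\<close>, then \<open>w = \<ell> b\<close> works. As the span is finite-dimensional, \<open>\<ell>\<close> comes from a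
  hyperplane in \<open>\<complex>\<^sup>2\<close> separating \<open>(1, 0)\<close> from the unit ball of the pulled-back seminorm \<open>N\<close>.
  Working in coordinates also covers linearly dependent \<open>a\<close>, \<open>b\<close>.
\<close>

lemma exists_norming_coefficient:
  fixes a b :: "'a::complex_banach"
  assumes a: "norm a = 1"
  obtains w :: complex where "\<And>z. cmod (1 + z * w) \<le> norm (a + z *\<^sub>C b)"
proof -
  define N :: "complex \<times> complex \<Rightarrow> real" where "N = (\<lambda>(x, y). norm (x *\<^sub>C a + y *\<^sub>C b))"
  have N_add: "N (s + t) \<le> N s + N t" for s t
  proof -
    have "(fst s + fst t) *\<^sub>C a + (snd s + snd t) *\<^sub>C b
        = (fst s *\<^sub>C a + snd s *\<^sub>C b) + (fst t *\<^sub>C a + snd t *\<^sub>C b)"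
      by (simp add: scaleC_add_left)
    then show ?thesis
      unfolding N_def by (simp add: case_prod_beta norm_triangle_ineq)
  qed
  have N_mult: "N (c * x, c * y) = cmod c * N (x, y)" for c x y
  proof -
    have "(c * x) *\<^sub>C a + (c * y) *\<^sub>C b = c *\<^sub>C (x *\<^sub>C a + y *\<^sub>C b)"
      by (simp add: scaleC_add_right scaleC_scaleC)
    then show ?thesis by (simp add: N_def norm_scaleC)
  qed
  have N_scaleR: "N (r *\<^sub>R s) = \<bar>r\<bar> * N s" for r s
    using N_mult[of "complex_of_real r" "fst s" "snd s"]
    by (simp add: scaleR_conv_of_real scaleR_prod_def)
  have N_one: "N (1, 0) = 1"
    by (simp add: N_def a scaleC_one)
  define S where "S = {s. N s < 1}"
  have "convex S"
  proof (rule convexI)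
    fix s t and u v :: real
    assume st: "s \<in> S" "t \<in> S" and uv: "0 \<le> u" "0 \<le> v" "u + v = 1"
    have "N (u *\<^sub>R s + v *\<^sub>R t) \<le> u * N s + v * N t"
      using N_add[of "u *\<^sub>R s" "v *\<^sub>R t"] uv by (simp add: N_scaleR)
    also have "\<dots> < 1"
      using convex_bound_lt[of "N s" 1 "N t" u v] st uv by (simp add: S_def)
    finally show "u *\<^sub>R s + v *\<^sub>R t \<in> S" by (simp add: S_def)
  qed
  moreover have zero: "(0, 0) \<in> S" by (simp add: S_def N_def)
  moreover have "S \<inter> {(1, 0)} = {}" using N_one by (auto simp: S_def)
  ultimately obtain h \<beta> where h: "h \<noteq> 0" "\<And>s. s \<in> S \<Longrightarrow> h \<bullet> s \<le> \<beta>" "\<beta> \<le> h \<bullet> (1, 0)"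
    using separating_hyperplane_sets[of S "{(1, 0)}"]
    by (metis convex_singleton empty_iff insert_iff insert_not_empty)
  obtain p q where pq: "h = (p, q)" by (cases h)
  define L where "L x y = cnj p * x + cnj q * y" for x y
  have inner_L: "h \<bullet> (x, y) = Re (L x y)" for x y
    by (simp add: pq L_def inner_complex_def)
  have bound: "Re (L x y) \<le> Re p" if "N (x, y) < 1" for x y
    using h(2)[of "(x, y)"] h(3) that inner_L[of x y] inner_L[of 1 0] by (simp add: S_def L_def)
  have Re_p: "0 \<le> Re p"
    using bound[of 0 0] zero by (simp add: S_def L_def)
  have L_le: "cmod (L x y) \<le> N (x, y) * Re p" for x y
  proof (cases "L x y = 0")
    case True
    then show ?thesis using Re_p by (simp add: N_def)
  next
    case False
    have "cmod (L x y) \<le> r * Re p" if r: "N (x, y) < r" for r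
    proof -
      have r0: "r > 0" using r by (rule le_less_trans[rotated]) (simp add: N_def)
      \<comment> \<open>The phase of \<open>c\<close> turns \<open>L\<close> into its modulus, so the real bound becomes a complex one.\<close>
      define c where "c = cnj (L x y) / (cmod (L x y) * r)"
      have "cmod c = 1 / r" using False r0 by (simp add: c_def norm_divide norm_mult)
      then have "N (c * x, c * y) < 1" using r r0 by (simp add: N_mult)
      from bound[OF this] have "Re (L (c * x) (c * y)) \<le> Re p" .
      moreover have "L (c * x) (c * y) = c * L x y" by (simp add: L_def algebra_simps)
      moreover have "c * L x y = complex_of_real (cmod (L x y) / r)"
      proof -
        have "cnj (L x y) * L x y = complex_of_real ((cmod (L x y))\<^sup>2)"
          by (subst complex_norm_square) (rule mult.commute)
        then show ?thesis using False r0 by (simp add: c_def power2_eq_square)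
      qed
      ultimately show ?thesis using r0 by (simp add: field_simps)
    qed
    then have *: "cmod (L x y) \<le> (N (x, y) + e) * Re p" if "e > 0" for e
      using that by simp
    show ?thesis
    proof (rule field_le_epsilon)
      fix e :: real assume e: "0 < e"
      have "e / (Re p + 1) * Re p \<le> e"
        using e Re_p by (simp add: field_simps)
      then show "cmod (L x y) \<le> N (x, y) * Re p + e"
        using *[of "e / (Re p + 1)"] e Re_p by (simp add: distrib_right)
    qed
  qed
  \<comment> \<open>Dividing by \<open>L 1 0 = cnj p\<close> normalises the functional; for that \<open>p\<close> has to be real and positive.\<close>
  have "Re p \<noteq> 0"
  proof
    assume "Re p = 0"
    then have "L x y = 0" for x y using L_le[of x y] by simp
    from this[of 1 0] this[of 0 1] have "p = 0" "q = 0" by (simp_all add: L_def)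
    then show False using h(1) pq by (simp add: zero_prod_def)
  qed
  with Re_p have pos: "Re p > 0" by simp
  have "cmod p \<le> Re p" using L_le[of 1 0] N_one by (simp add: L_def)
  then have "(Re p)\<^sup>2 + (Im p)\<^sup>2 \<le> (Re p)\<^sup>2"
    using pos by (metis cmod_power2 norm_ge_zero power_mono)
  then have "Im p = 0" by simp
  then have p: "p = complex_of_real (Re p)" by (simp add: complex_eq_iff)
  have "cmod (1 + z * (cnj q / Re p)) \<le> norm (a + z *\<^sub>C b)" for z
  proof -
    have "L 1 z = Re p * (1 + z * (cnj q / Re p))"
      using pos by (subst (1) L_def, subst p) (simp add: field_simps)
    then have "Re p * cmod (1 + z * (cnj q / Re p)) \<le> norm (a + z *\<^sub>C b) * Re p"
      using L_le[of 1 z] pos by (simp add: norm_mult N_def scaleC_one)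
    then show ?thesis using pos by (simp add: mult.commute)
  qed
  then show thesis by (rule that)
qed

section \<open>Means over the circle\<close>

definition mean :: "(real \<Rightarrow> real) \<Rightarrow> real" where
  "mean h = 1 / (2 * pi) * integral {0..2 * pi} h"

lemma mean_const [simp]: "mean (\<lambda>_. k) = k"
  by (simp add: mean_def)

lemma mean_mult: "mean (\<lambda>\<theta>. k * h \<theta>) = k * mean h"
  by (simp add: mean_def)

lemma mean_add:
  "continuous_on {0..2 * pi} g \<Longrightarrow> continuous_on {0..2 * pi} h \<Longrightarrow>
   mean (\<lambda>\<theta>. g \<theta> + h \<theta>) = mean g + mean h"
  by (simp add: mean_def integral_add integrable_continuous_real distrib_left)

lemma mean_affine:
  "continuous_on {0..2 * pi} g \<Longrightarrow> mean (\<lambda>\<theta>. r * g \<theta> + k) = r * mean g + k"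
  by (simp add: mean_add mean_mult continuous_on_mult_left)

lemma mean_combination:
  assumes "continuous_on {0..2 * pi} g" "continuous_on {0..2 * pi} h"
  shows "mean (\<lambda>\<theta>. r * g \<theta> + s * h \<theta> + k) = r * mean g + s * mean h + k"
  using mean_add[of "\<lambda>\<theta>. r * g \<theta>" "\<lambda>\<theta>. s * h \<theta> + k"] assms
  by (simp add: mean_affine mean_mult continuous_on_mult_left continuous_on_add add.assoc)

lemma mean_mono:
  "continuous_on {0..2 * pi} g \<Longrightarrow> continuous_on {0..2 * pi} h \<Longrightarrow>
   (\<And>\<theta>. g \<theta> \<le> h \<theta>) \<Longrightarrow> mean g \<le> mean h"
  unfolding mean_def
  by (intro mult_left_mono integral_le integrable_continuous_real) auto

lemma mean_Re_rotation: "mean (\<lambda>\<theta>. Re (cis \<theta> * w)) = 0"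
proof -
  have "((\<lambda>\<theta>. Re (cis \<theta> * w)) has_integral Im (cis (2 * pi) * w) - Im (cis 0 * w)) {0..2 * pi}"
    by (rule fundamental_theorem_of_calculus)
       (auto intro!: derivative_eq_intros simp: has_real_derivative_iff_has_vector_derivative[symmetric])
  then show ?thesis by (simp add: mean_def integral_unique)
qed

lemma mean_Im_rotation_squared: "mean (\<lambda>\<theta>. (Im (cis \<theta> * w))\<^sup>2) = (cmod w)\<^sup>2 / 2"
proof -
  define R where "R \<theta> = Re (cis \<theta> * w)" for \<theta>
  define I where "I \<theta> = Im (cis \<theta> * w)" for \<theta>
  define F where "F \<theta> = (cmod w)\<^sup>2 * \<theta> / 2 - R \<theta> * I \<theta> / 2" for \<theta>
  have "((\<lambda>\<theta>. (I \<theta>)\<^sup>2) has_integral F (2 * pi) - F 0) {0..2 * pi}"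
  proof (rule fundamental_theorem_of_calculus)
    fix \<theta> :: real
    have "(cmod w)\<^sup>2 = (R \<theta>)\<^sup>2 + (I \<theta>)\<^sup>2"
      unfolding R_def I_def by (metis cmod_power2 norm_mult norm_cis mult_1)
    moreover have "(R has_real_derivative - I \<theta>) (at \<theta> within {0..2 * pi})"
      unfolding R_def I_def by (auto intro!: derivative_eq_intros)
    moreover have "(I has_real_derivative R \<theta>) (at \<theta> within {0..2 * pi})"
      unfolding R_def I_def by (auto intro!: derivative_eq_intros)
    ultimately have "(F has_real_derivative (I \<theta>)\<^sup>2) (at \<theta> within {0..2 * pi})"
      unfolding F_def
      by (auto intro!: derivative_eq_intros simp: power2_eq_square field_simps)
    then show "(F has_vector_derivative (I \<theta>)\<^sup>2) (at \<theta> within {0..2 * pi})"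
      by (simp add: has_real_derivative_iff_has_vector_derivative)
  qed simp
  moreover have "F (2 * pi) - F 0 = pi * (cmod w)\<^sup>2"
    by (simp add: F_def R_def I_def)
  ultimately show ?thesis by (simp add: mean_def integral_unique I_def)
qed

text \<open>
  This is Jensen's inequality. The tangent to \<open>y \<mapsto> y\<^sup>r\<close>, \<open>r = p / q\<close>, at the mean \<open>Y\<close> of
  \<open>f\<^sup>q\<close> lies below the graph (which is Young's inequality), and integrating the tangent at
  \<open>y = f\<^sup>q\<close> gives \<open>Y\<^sup>r \<le> mean f\<^sup>p\<close>.
\<close>

lemma mean_powr_mono:
  fixes f :: "real \<Rightarrow> real"
  assumes f: "continuous_on {0..2 * pi} f" "\<And>\<theta>. 0 \<le> f \<theta>"
    and q: "0 < q" "q < p" and pos: "0 < mean (\<lambda>\<theta>. f \<theta> powr q)"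
  shows "mean (\<lambda>\<theta>. f \<theta> powr q) powr (1 / q) \<le> mean (\<lambda>\<theta>. f \<theta> powr p) powr (1 / p)"
proof -
  define r where "r = p / q"
  define Y where "Y = mean (\<lambda>\<theta>. f \<theta> powr q)"
  have r: "r > 1" using q by (simp add: r_def)
  have Y: "Y > 0" using pos by (simp add: Y_def)
  have cont: "continuous_on {0..2 * pi} (\<lambda>\<theta>. f \<theta> powr s)" if "s > 0" for s
    using f that by (intro continuous_on_powr') auto
  have "r * Y powr (r - 1) * f \<theta> powr q \<le> f \<theta> powr p + (r - 1) * Y powr r" for \<theta>
  proof -
    have "f \<theta> powr q * Y powr (r - 1)
        \<le> (f \<theta> powr q) powr r / r + (Y powr (r - 1)) powr (r / (r - 1)) / (r / (r - 1))"
      using r by (intro Youngs_inequality) (auto simp: field_simps)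
    also have "(f \<theta> powr q) powr r = f \<theta> powr p" using q by (simp add: powr_powr r_def)
    also have "(Y powr (r - 1)) powr (r / (r - 1)) = Y powr r" using r by (simp add: powr_powr)
    finally show ?thesis using r by (simp add: field_simps)
  qed
  then have "mean (\<lambda>\<theta>. r * Y powr (r - 1) * f \<theta> powr q)
      \<le> mean (\<lambda>\<theta>. f \<theta> powr p + (r - 1) * Y powr r)"
    using q by (intro mean_mono continuous_intros cont) auto
  then have "r * Y powr (r - 1) * Y \<le> mean (\<lambda>\<theta>. f \<theta> powr p) + (r - 1) * Y powr r"
    using q by (simp add: mean_mult mean_add cont Y_def)
  moreover have "Y powr (r - 1) * Y = Y powr r"
    using Y by (simp add: powr_diff)
  then have "r * Y powr (r - 1) * Y = r * Y powr r"
    by simp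
  ultimately have "Y powr r \<le> mean (\<lambda>\<theta>. f \<theta> powr p)"
    by (simp add: left_diff_distrib)
  then have "(Y powr r) powr (1 / p) \<le> mean (\<lambda>\<theta>. f \<theta> powr p) powr (1 / p)"
    using q by (intro powr_mono2) auto
  then show ?thesis using q by (simp add: powr_powr r_def Y_def)
qed

section \<open>Lowering the exponent to one\<close>

text \<open>
  The constant is not sharp; it only has to be independent of \<open>u\<close>, and \<open>3\<^sup>n\<close> closes the induction
  because \<open>n + 2 \<cdot> 3\<^sup>n \<le> 3\<^sup>n\<^sup>+\<^sup>1\<close>.
\<close>

lemma power_one_plus_le_quadratic:
  fixes u :: real
  assumes "-1 \<le> u" "u \<le> 1"
  shows "(1 + u) ^ n \<le> 1 + n * u + 3 ^ n * u\<^sup>2"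
proof (induction n)
  case 0
  then show ?case by simp
next
  case (Suc n)
  have n: "real n \<le> 3 ^ n"
    using of_nat_mono[OF less_imp_le[OF less_exp[of n]], where ?'a = real]
      power_mono[of "2::real" 3 n] by simp
  have "(1 + u) ^ Suc n \<le> (1 + n * u + 3 ^ n * u\<^sup>2) * (1 + u)"
    using Suc assms by (simp add: mult.commute mult_left_mono)
  also have "\<dots> = 1 + Suc n * u + (n + 3 ^ n * (1 + u)) * u\<^sup>2"
    by (simp add: algebra_simps power2_eq_square)
  also have "(n + 3 ^ n * (1 + u)) * u\<^sup>2 \<le> 3 ^ Suc n * u\<^sup>2"
  proof (rule mult_right_mono)
    have "3 ^ n * (1 + u) \<le> 3 ^ n * 2" using assms by (intro mult_left_mono) auto
    then show "n + 3 ^ n * (1 + u) \<le> 3 ^ Suc n"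
      unfolding power_Suc using n by linarith
  qed simp
  finally show ?case by simp
qed

text \<open>
  The second-order gain of the modulus over its linearisation comes from the direction
  perpendicular to \<open>1\<close>. It is what a real norming functional would not see.
\<close>

lemma norm_one_plus_ge:
  assumes "cmod t \<le> 1"
  shows "1 + Re t + (Im t)\<^sup>2 / 8 \<le> cmod (1 + t)"
proof -
  have "\<bar>Re t\<bar> \<le> 1" "\<bar>Im t\<bar> \<le> 1"
    using assms abs_Re_le_cmod[of t] abs_Im_le_cmod[of t] by linarith+
  then have s: "(Im t)\<^sup>2 \<le> 1" and x: "0 \<le> 1 + Re t" "1 + Re t \<le> 2"
    by (auto simp: abs_square_le_1)
  define x y where "x = 1 + Re t" and "y = (Im t)\<^sup>2"
  have y: "0 \<le> y" "y \<le> 1" and "x \<le> 2"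
    using x s by (simp_all add: x_def y_def)
  then have "x * y \<le> 2 * y" "y * y \<le> 1 * y"
    by (intro mult_right_mono; simp)+
  with y have "x * x + x * y / 4 + y * y / 64 \<le> x * x + y" by linarith
  then have "(x + y / 8)\<^sup>2 \<le> x\<^sup>2 + y" by (simp add: power2_eq_square algebra_simps)
  then have "(1 + Re t + (Im t)\<^sup>2 / 8)\<^sup>2 \<le> (1 + Re t)\<^sup>2 + (Im t)\<^sup>2"
    by (simp only: x_def y_def)
  then have "(1 + Re t + (Im t)\<^sup>2 / 8)\<^sup>2 \<le> (cmod (1 + t))\<^sup>2"
    by (simp add: cmod_power2)
  then show ?thesis
    by (rule power2_le_imp_le) simp
qed

text \<open>
  With \<open>w\<close> the norming coefficient, \<open>x = Re (e\<^sup>i\<^sup>\<theta>w)\<close> and \<open>u = \<parallel>a + e\<^sup>i\<^sup>\<theta>b\<parallel> - 1\<close>, the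
  remainder \<open>v = u - x\<close> lies in \<open>[0, 2]\<close>, so \<open>u\<^sup>2 \<le> 2v\<^sup>2 + 2x\<^sup>2 \<le> 4v + 2\<bar>w\<bar>\<^sup>2\<close>. The mean of
  \<open>v\<close> equals that of \<open>u\<close>, because \<open>x\<close> has mean zero, and \<open>\<bar>w\<bar>\<^sup>2 \<le> 16 mean u\<close> by the
  second-order gain. This adds up to \<open>4 + 32 = 36\<close>.
\<close>

lemma mean_square_increment_le:
  fixes a b :: "'a::complex_banach"
  assumes a: "norm a = 1" and b: "norm b \<le> 1"
  shows "mean (\<lambda>\<theta>. (norm (a + cis \<theta> *\<^sub>C b) - 1)\<^sup>2) \<le> 36 * (mean (\<lambda>\<theta>. norm (a + cis \<theta> *\<^sub>C b)) - 1)"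
proof -
  define f where "f \<theta> = norm (a + cis \<theta> *\<^sub>C b)" for \<theta>
  have cont [continuous_intros]: "continuous_on S f" for S
    unfolding f_def by (rule continuous_on_circle_norm)
  obtain w where w: "\<And>z. cmod (1 + z * w) \<le> norm (a + z *\<^sub>C b)"
    using exists_norming_coefficient[OF a, of b] by blast
  have f_le: "f \<theta> \<le> 2" for \<theta>
    using norm_triangle_ineq[of a "cis \<theta> *\<^sub>C b"] a b by (simp add: f_def)
  have w_le: "cmod w \<le> 1"
  proof (cases "w = 0")
    case False
    \<comment> \<open>The direction in which \<open>\<bar>1 + zw\<bar>\<close> is largest.\<close>
    define z where "z = cnj w / cmod w"
    have "cmod z = 1" using False by (simp add: z_def norm_divide)
    moreover have "cmod (1 + complex_of_real (cmod w)) = 1 + cmod w"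
      using norm_of_real[of "1 + cmod w", where ?'a = complex] by (simp add: abs_of_nonneg)
    moreover have "z * w = cmod w"
      using False complex_norm_square[of w] by (simp add: z_def field_simps power2_eq_square)
    ultimately have "1 + cmod w \<le> norm (a + z *\<^sub>C b)" "norm (a + z *\<^sub>C b) \<le> 1 + norm b"
      using w[of z] norm_triangle_ineq[of a "z *\<^sub>C b"] a
      by (simp_all add: norm_scaleC)
    then show ?thesis using b by simp
  qed simp
  have lower: "1 + Re (cis \<theta> * w) + (Im (cis \<theta> * w))\<^sup>2 / 8 \<le> f \<theta>" for \<theta>
    using norm_one_plus_ge[of "cis \<theta> * w"] w[of "cis \<theta>"] w_le
    by (simp add: f_def norm_mult)
  have cont_rot [continuous_intros]:
    "continuous_on S (\<lambda>\<theta>. Re (cis \<theta> * w))" "continuous_on S (\<lambda>\<theta>. Im (cis \<theta> * w))" for S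
    by (intro continuous_intros)+
  have "mean (\<lambda>\<theta>. 1 * Re (cis \<theta> * w) + 1 / 8 * (Im (cis \<theta> * w))\<^sup>2 + 1) \<le> mean f"
  proof (intro mean_mono)
    show "1 * Re (cis \<theta> * w) + 1 / 8 * (Im (cis \<theta> * w))\<^sup>2 + 1 \<le> f \<theta>" for \<theta>
      using lower[of \<theta>] by linarith
  qed (intro continuous_intros)+
  also have "mean (\<lambda>\<theta>. 1 * Re (cis \<theta> * w) + 1 / 8 * (Im (cis \<theta> * w))\<^sup>2 + 1)
      = 1 * mean (\<lambda>\<theta>. Re (cis \<theta> * w)) + 1 / 8 * mean (\<lambda>\<theta>. (Im (cis \<theta> * w))\<^sup>2) + 1"
    by (intro mean_combination continuous_intros)
  also have "\<dots> = (cmod w)\<^sup>2 / 16 + 1"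
    unfolding mean_Re_rotation mean_Im_rotation_squared by simp
  finally have m: "(cmod w)\<^sup>2 \<le> 16 * (mean f - 1)" by simp
  have "(f \<theta> - 1)\<^sup>2 \<le> 4 * f \<theta> + (-4) * Re (cis \<theta> * w) + (2 * (cmod w)\<^sup>2 - 4)" for \<theta>
  proof -
    define x where "x = Re (cis \<theta> * w)"
    have x: "\<bar>x\<bar> \<le> cmod w" using abs_Re_le_cmod[of "cis \<theta> * w"] by (simp add: x_def norm_mult)
    have x2: "x\<^sup>2 \<le> (cmod w)\<^sup>2" using power_mono[OF x, of 2] by simp
    define v where "v = f \<theta> - 1 - x"
    have v: "0 \<le> v" "v \<le> 2"
      using lower[of \<theta>] f_le[of \<theta>] x w_le zero_le_power2[of "Im (cis \<theta> * w)"]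
      unfolding v_def x_def[symmetric] by linarith+
    have "v * v \<le> 2 * v" using v by (intro mult_right_mono)
    moreover have "0 \<le> (v - x) * (v - x)" by simp
    moreover have "f \<theta> - 1 = v + x" by (simp add: v_def)
    then have "(f \<theta> - 1)\<^sup>2 = v * v + 2 * (v * x) + x\<^sup>2"
      by (simp add: power2_eq_square algebra_simps)
    ultimately have "(f \<theta> - 1)\<^sup>2 \<le> 4 * v + 2 * (cmod w)\<^sup>2"
      using x2 by (simp add: power2_eq_square algebra_simps)
    then show ?thesis by (simp add: v_def x_def)
  qed
  then have "mean (\<lambda>\<theta>. (f \<theta> - 1)\<^sup>2)
      \<le> mean (\<lambda>\<theta>. 4 * f \<theta> + (-4) * Re (cis \<theta> * w) + (2 * (cmod w)\<^sup>2 - 4))"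
    by (intro mean_mono continuous_intros)
  also have "\<dots> = 4 * mean f + (-4) * mean (\<lambda>\<theta>. Re (cis \<theta> * w)) + (2 * (cmod w)\<^sup>2 - 4)"
    by (intro mean_combination continuous_intros)
  finally show ?thesis using m unfolding mean_Re_rotation by (simp add: f_def[abs_def])
qed

text \<open>
  The constant is also made at most one, as needed at \<open>a = 0\<close>, where the mean equals \<open>\<parallel>b\<parallel>\<close>.
\<close>

lemma mean_norm_ge_unit:
  assumes "two_uniformly_PL_convex TYPE('a::complex_banach)"
  obtains \<kappa> where "0 < \<kappa>" "\<kappa> \<le> 1"
    "\<And>a b :: 'a. norm a = 1 \<Longrightarrow> norm b \<le> 1 \<Longrightarrow>
       1 + \<kappa> * (norm b)\<^sup>2 \<le> mean (\<lambda>\<theta>. norm (a + cis \<theta> *\<^sub>C b))"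
proof -
  obtain q c where q: "q > 0" and c: "c > 0" and
    PL: "\<And>a b :: 'a. sqrt ((norm a)\<^sup>2 + c * (norm b)\<^sup>2)
          \<le> mean (\<lambda>\<theta>. norm (a + cis \<theta> *\<^sub>C b) powr q) powr (1 / q)"
    using assms unfolding two_uniformly_PL_convex_def mean_def by blast
  obtain n :: nat where "max 2 q < n" using reals_Archimedean2 by blast
  then have n: "2 \<le> n" "q < n" by auto
  \<comment> \<open>The factor of \<open>mean u\<close> in the quadratic bound, after \<open>mean u\<^sup>2\<close> is replaced by \<open>36 mean u\<close>.\<close>
  define K where "K = real n + 36 * 3 ^ n"
  have K: "K > 0" unfolding K_def by (intro add_nonneg_pos) auto
  have "1 + c / K * (norm b)\<^sup>2 \<le> mean (\<lambda>\<theta>. norm (a + cis \<theta> *\<^sub>C b))"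
    if a: "norm a = 1" and b: "norm b \<le> 1" for a b :: 'a
  proof -
    define f where "f \<theta> = norm (a + cis \<theta> *\<^sub>C b)" for \<theta>
    have cont [continuous_intros]: "continuous_on S f" for S
      unfolding f_def by (rule continuous_on_circle_norm)
    have f0: "0 \<le> f \<theta>" for \<theta> by (simp add: f_def)
    define Q where "Q = 1 + c * (norm b)\<^sup>2"
    have Q: "Q \<ge> 1" using c by (simp add: Q_def)
    have sqrtQ: "sqrt Q \<le> mean (\<lambda>\<theta>. f \<theta> powr q) powr (1 / q)"
      using PL[of a b] a by (simp add: f_def Q_def)
    have "mean (\<lambda>\<theta>. f \<theta> powr q) \<noteq> 0"
      using sqrtQ Q by auto
    moreover have "0 \<le> mean (\<lambda>\<theta>. f \<theta> powr q)"
      unfolding mean_def by (intro mult_nonneg_nonneg integral_nonneg)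
        (use q f0 in \<open>auto intro!: integrable_continuous_real continuous_on_powr' cont\<close>)
    ultimately have "sqrt Q \<le> mean (\<lambda>\<theta>. f \<theta> powr n) powr (1 / n)"
      using sqrtQ mean_powr_mono[OF cont f0 q n(2)] by simp
    moreover have fn: "f \<theta> powr n = f \<theta> ^ n" for \<theta>
      using n f0[of \<theta>] by (intro powr_realpow') auto
    moreover have "0 \<le> mean (\<lambda>\<theta>. f \<theta> ^ n)"
      unfolding mean_def by (intro mult_nonneg_nonneg integral_nonneg)
        (use f0 in \<open>auto intro!: integrable_continuous_real continuous_intros cont\<close>)
    moreover from this have "(mean (\<lambda>\<theta>. f \<theta> ^ n) powr (1 / n)) ^ n = mean (\<lambda>\<theta>. f \<theta> ^ n)"
      using n by (simp add: powr_powr flip: powr_realpow')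
    ultimately have "sqrt Q ^ n \<le> mean (\<lambda>\<theta>. f \<theta> ^ n)"
      using power_mono[of "sqrt Q" "mean (\<lambda>\<theta>. f \<theta> ^ n) powr (1 / n)" n] Q
      by simp
    \<comment> \<open>The exponent \<open>n \<ge> 2\<close> absorbs the square root, so the gain stays linear in \<open>\<parallel>b\<parallel>\<^sup>2\<close>.\<close>
    moreover have "Q \<le> sqrt Q ^ n"
      using power_increasing[OF n(1), of "sqrt Q"] Q by simp
    moreover have "mean (\<lambda>\<theta>. f \<theta> ^ n)
        \<le> mean (\<lambda>\<theta>. n * f \<theta> + 3 ^ n * (f \<theta> - 1)\<^sup>2 + (1 - real n))"
    proof (intro mean_mono continuous_intros)
      fix \<theta>
      have "\<bar>f \<theta> - 1\<bar> \<le> 1"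
        using norm_triangle_ineq3[of "a + cis \<theta> *\<^sub>C b" a] a b by (simp add: f_def)
      then show "f \<theta> ^ n \<le> n * f \<theta> + 3 ^ n * (f \<theta> - 1)\<^sup>2 + (1 - real n)"
        using power_one_plus_le_quadratic[of "f \<theta> - 1" n] by (simp add: algebra_simps)
    qed
    moreover have "mean (\<lambda>\<theta>. n * f \<theta> + 3 ^ n * (f \<theta> - 1)\<^sup>2 + (1 - real n))
        = n * mean f + 3 ^ n * mean (\<lambda>\<theta>. (f \<theta> - 1)\<^sup>2) + (1 - real n)"
      by (intro mean_combination continuous_intros)
    moreover have "3 ^ n * mean (\<lambda>\<theta>. (f \<theta> - 1)\<^sup>2) \<le> 3 ^ n * (36 * (mean f - 1))"
      using mean_square_increment_le[OF a b] by (intro mult_left_mono) (simp_all add: f_def[abs_def])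
    ultimately have "c * (norm b)\<^sup>2 \<le> K * (mean f - 1)"
      unfolding K_def Q_def by (simp add: algebra_simps)
    then show ?thesis using K by (simp add: f_def[abs_def] field_simps)
  qed
  then have "1 + min 1 (c / K) * (norm b)\<^sup>2 \<le> mean (\<lambda>\<theta>. norm (a + cis \<theta> *\<^sub>C b))"
    if "norm a = 1" "norm b \<le> 1" for a b :: 'a
    using that mult_right_mono[of "min 1 (c / K)" "c / K" "(norm b)\<^sup>2"] by fastforce
  then show thesis using c K by (intro that[of "min 1 (c / K)"]) auto
qed

section \<open>Arbitrary centres\<close>

lemma mean_norm_ge_small:
  fixes a b :: "'a::complex_banach"
  assumes unit: "\<And>a b :: 'a. norm a = 1 \<Longrightarrow> norm b \<le> 1 \<Longrightarrow>
       1 + \<kappa> * (norm b)\<^sup>2 \<le> mean (\<lambda>\<theta>. norm (a + cis \<theta> *\<^sub>C b))"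
    and a: "a \<noteq> 0" and b: "norm b \<le> norm a"
  shows "norm a + \<kappa> * (norm b)\<^sup>2 / norm a \<le> mean (\<lambda>\<theta>. norm (a + cis \<theta> *\<^sub>C b))"
proof -
  define r where "r = 1 / norm a"
  have r: "r > 0" using a by (simp add: r_def)
  have "1 + \<kappa> * (norm (r *\<^sub>R b))\<^sup>2 \<le> mean (\<lambda>\<theta>. norm (r *\<^sub>R a + cis \<theta> *\<^sub>C (r *\<^sub>R b)))"
    using a b by (intro unit) (simp_all add: r_def)
  also have "(\<lambda>\<theta>. norm (r *\<^sub>R a + cis \<theta> *\<^sub>C (r *\<^sub>R b))) = (\<lambda>\<theta>. r * norm (a + cis \<theta> *\<^sub>C b))"
    using r by (simp add: scaleC_scaleR flip: scaleR_add_right)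
  also have "mean \<dots> = r * mean (\<lambda>\<theta>. norm (a + cis \<theta> *\<^sub>C b))"
    by (rule mean_mult)
  finally have "norm a * (1 + \<kappa> * (norm b / norm a)\<^sup>2) \<le> mean (\<lambda>\<theta>. norm (a + cis \<theta> *\<^sub>C b))"
    using a by (simp add: r_def pos_le_divide_eq mult.commute)
  also have "norm a * (1 + \<kappa> * (norm b / norm a)\<^sup>2) = norm a + \<kappa> * (norm b)\<^sup>2 / norm a"
    using a by (simp add: power2_eq_square field_simps)
  finally show ?thesis .
qed

text \<open>
  If \<open>\<parallel>b\<parallel> > \<parallel>a\<parallel> > 0\<close>, write \<open>a + e\<^sup>i\<^sup>\<theta>sb\<close> with \<open>s = \<parallel>a\<parallel>/\<parallel>b\<parallel>\<close> as a convex combination of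
  \<open>a + e\<^sup>i\<^sup>\<theta>b\<close> and \<open>a\<close>. The excess at \<open>b\<close> is then at least \<open>1/s\<close> times the excess at \<open>sb\<close>, which is
  \<open>\<kappa>\<parallel>a\<parallel>\<close> since \<open>\<parallel>sb\<parallel> = \<parallel>a\<parallel>\<close>. The resulting \<open>\<kappa>\<parallel>b\<parallel>\<close> beats \<open>\<kappa>\<parallel>b\<parallel>\<^sup>2\<close> as \<open>\<parallel>b\<parallel> \<le> 1\<close>.
\<close>

lemma mean_norm_ge:
  fixes a b :: "'a::complex_banach"
  assumes \<kappa>: "0 < \<kappa>" "\<kappa> \<le> 1"
    and unit: "\<And>a b :: 'a. norm a = 1 \<Longrightarrow> norm b \<le> 1 \<Longrightarrow>
       1 + \<kappa> * (norm b)\<^sup>2 \<le> mean (\<lambda>\<theta>. norm (a + cis \<theta> *\<^sub>C b))"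
    and b: "norm b \<le> 1"
  shows "norm a + \<kappa> / (1 + norm a) * (norm b)\<^sup>2 \<le> mean (\<lambda>\<theta>. norm (a + cis \<theta> *\<^sub>C b))"
proof -
  have phi_le: "\<kappa> / (1 + norm a) * (norm b)\<^sup>2 \<le> \<kappa> * norm b"
  proof -
    have "\<kappa> / (1 + norm a) \<le> \<kappa> / 1"
      using \<kappa> by (intro divide_left_mono) (auto intro: add_pos_nonneg)
    moreover have "(norm b)\<^sup>2 \<le> norm b" using b by (simp add: power2_eq_square mult_left_le)
    ultimately show ?thesis using \<kappa> by (intro mult_mono) auto
  qed
  consider "a = 0" | "a \<noteq> 0" "norm b \<le> norm a" | "a \<noteq> 0" "norm a < norm b" by linarith
  then show ?thesis
  proof cases
    case 1
    have "\<kappa> * norm b \<le> norm b" using \<kappa> by (simp add: mult_left_le_one_le)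
    then show ?thesis using 1 phi_le by simp
  next
    case 2
    have "\<kappa> / (1 + norm a) * (norm b)\<^sup>2 \<le> \<kappa> / norm a * (norm b)\<^sup>2"
      using 2 \<kappa> by (intro mult_right_mono divide_left_mono) (auto intro!: mult_pos_pos add_pos_nonneg)
    then show ?thesis using mean_norm_ge_small[OF unit 2] by simp
  next
    case 3
    define s where "s = norm a / norm b"
    have b0: "norm b > 0" using 3 norm_ge_zero[of a] by linarith
    have s: "0 < s" "s < 1" using 3 b0 by (simp_all add: s_def)
    have sb: "norm (s *\<^sub>R b) = norm a" using b0 by (simp add: s_def)
    have "norm a + \<kappa> * norm a \<le> mean (\<lambda>\<theta>. norm (a + cis \<theta> *\<^sub>C (s *\<^sub>R b)))"
      using mean_norm_ge_small[OF unit 3(1), of "s *\<^sub>R b"] 3 sb by (simp add: power2_eq_square)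
    also have "\<dots> \<le> mean (\<lambda>\<theta>. s * norm (a + cis \<theta> *\<^sub>C b) + (1 - s) * norm a)"
    proof (rule mean_mono)
      fix \<theta>
      have "a + cis \<theta> *\<^sub>C (s *\<^sub>R b) = s *\<^sub>R (a + cis \<theta> *\<^sub>C b) + (1 - s) *\<^sub>R a"
        by (simp add: scaleC_scaleR algebra_simps)
      then show "norm (a + cis \<theta> *\<^sub>C (s *\<^sub>R b)) \<le> s * norm (a + cis \<theta> *\<^sub>C b) + (1 - s) * norm a"
        using norm_triangle_ineq[of "s *\<^sub>R (a + cis \<theta> *\<^sub>C b)" "(1 - s) *\<^sub>R a"] s by simp
    qed (intro continuous_on_circle_norm continuous_on_add continuous_on_mult_left continuous_on_const)+
    also have "\<dots> = s * mean (\<lambda>\<theta>. norm (a + cis \<theta> *\<^sub>C b)) + (1 - s) * norm a"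
      by (intro mean_affine continuous_on_circle_norm)
    finally have "s * norm a + \<kappa> * norm a \<le> s * mean (\<lambda>\<theta>. norm (a + cis \<theta> *\<^sub>C b))"
      by (simp add: algebra_simps)
    moreover have "norm a = s * norm b" using b0 by (simp add: s_def)
    ultimately have "s * (norm a + \<kappa> * norm b) \<le> s * mean (\<lambda>\<theta>. norm (a + cis \<theta> *\<^sub>C b))"
      by (simp add: algebra_simps)
    then show ?thesis using s phi_le by simp
  qed
qed

lemma circle_mean_norm:
  "circle_mean (\<lambda>x. ereal (norm x)) a (b :: 'a::complex_banach)
     = ereal (mean (\<lambda>\<theta>. norm (a + cis \<theta> *\<^sub>C b)))"
proof -
  let ?f = "\<lambda>\<theta>. norm (a + cis \<theta> *\<^sub>C b)"
  have int: "?f integrable_on {0..2 * pi}"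
    by (intro integrable_continuous_real continuous_on_circle_norm)
  have nonneg: "0 \<le> integral {0..2 * pi} ?f"
    by (intro integral_nonneg int) simp
  have "(\<integral>\<^sup>+\<theta>\<in>{0..2 * pi}. e2ennreal (ereal (?f \<theta>)) \<partial>lborel) = ennreal (integral {0..2 * pi} ?f)"
    using nn_integral_has_integral_lebesgue'[OF _ integrable_integral[OF int]]
    by (simp add: ennreal.rep_eq e2ennreal_ereal)
  moreover have "(\<integral>\<^sup>+\<theta>\<in>{0..2 * pi}. e2ennreal (- ereal (?f \<theta>)) \<partial>lborel) = 0"
    by (simp add: ennreal_neg)
  ultimately show ?thesis
    using nonneg by (simp add: circle_mean_def mean_def zero_ennreal.rep_eq enn2ereal_ennreal)
qed

theorem proposition2p11:
  assumes "two_uniformly_PL_convex TYPE('a::complex_banach)"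
  shows "strictly_psh_on_average_continuously (UNIV :: 'a set) (\<lambda>x. ereal (norm x))"
proof -
  obtain \<kappa> where \<kappa>: "0 < \<kappa>" "\<kappa> \<le> 1" and
    unit: "\<And>a b :: 'a. norm a = 1 \<Longrightarrow> norm b \<le> 1 \<Longrightarrow>
       1 + \<kappa> * (norm b)\<^sup>2 \<le> mean (\<lambda>\<theta>. norm (a + cis \<theta> *\<^sub>C b))"
    using mean_norm_ge_unit[OF assms] by blast
  define \<phi> where "\<phi> a = \<kappa> / (1 + norm a)" for a :: 'a
  have nz: "1 + norm x \<noteq> 0" for x :: 'a using norm_ge_zero[of x] by linarith
  have "usc_on UNIV (\<lambda>x :: 'a. ereal (norm x))"
    unfolding usc_on_def by (auto intro!: open_Collect_less continuous_intros)
  moreover have "continuous_on UNIV \<phi>"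
    unfolding \<phi>_def using nz by (intro continuous_intros) auto
  moreover have "\<phi> x > 0" for x using \<kappa> unfolding \<phi>_def by (intro divide_pos_pos add_pos_nonneg) auto
  moreover have "lsc_on UNIV (\<lambda>_ :: 'a. 1 :: real)"
    unfolding lsc_on_def by simp
  moreover have "ereal (\<phi> a * (norm b)\<^sup>2) + ereal (norm a) \<le> circle_mean (\<lambda>x. ereal (norm x)) a b"
    if "norm b < 1" for a b
    using mean_norm_ge[OF \<kappa> unit, of b a] that by (simp add: circle_mean_norm \<phi>_def add.commute)
  ultimately show ?thesis
    unfolding strictly_psh_on_average_continuously_def
    by (intro conjI exI[of _ \<phi>] exI[of _ "\<lambda>_. 1"]) auto
qed

end
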